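(* Let $I=\{1,\ldots,k\}$ and let $F=\{f_i\}_{i\in I}$ and $G=\{g_i\}_{i\in I}$ be finite frames for $\mathcal{H}^n$, consisting of nonzero vectors, with factor posets $\mathbb{F}_F$ and $\mathbb{F}_G$, respectively. Then $EC(\mathbb{F}_F)=EC(\mathbb{F}_G)$ if and only if $\mathbb{F}_F=\mathbb{F}_G$.
   Context: $\mathcal{H}^n$ denotes $\mathbb{R}^n$ or $\mathbb{C}^n$. A finite sequence $\{f_i\}_{i\in I}$ of vectors (repetitions allowed) in $\mathcal{H}^n$ is a frame for $\mathcal{H}^n$ if there are constants $A,B>0$ with $A\|f\|^2\le\sum_{i\in I}|\langle f,f_i\rangle|^2\le B\|f\|^2$ for all $f\in\mathcal{H}^n$. It is a tight frame if one can take $A=B$. The factor poset $\mathbb{F}_F$ of a finite frame $F=\{f_i\}_{i\in I}$ of nonzero vectors is the collection of subsets of $I$, ordered by inclusion, such that $\emptyset\in\mathbb{F}_F$ and a non-empty $J\subseteq I$ belongs to $\mathbb{F}_F$ if and only if $\{f_j\}_{j\in J}$ is a tight frame for $\mathcal{H}^n$. The empty cover of $\mathbb{F}_F$ is $EC(\mathbb{F}_F)=\{J\in\mathbb{F}_F : J\neq\emptyset$ and there is no $J'\in\mathbb{F}_F$ with $\emptyset\subsetneq J'\subsetneq J\}$. *)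

theory Defs
  imports "HOL-Analysis.Analysis" "Jordan_Normal_Form.Conjugate"
begin

text \<open>
  At the scalar types \<open>real\<close> and \<open>complex\<close>, where \<^const>\<open>conjugate\<close> is the identity
  and complex conjugation respectively, this is the standard inner product, and \<^const>\<open>norm\<close>
  on vectors is the norm it induces.  Other instances of the type class are not intended.
  The library's
  \<^const>\<open>inner\<close> is not suitable here: on complex vectors it is the real part of the Hermitian
  product.
\<close>

definition hinner :: "('a::{real_normed_field,conjugate})^'n \<Rightarrow> 'a^'n \<Rightarrow> 'a" where
  "hinner x y = (\<Sum>i\<in>UNIV. x $ i * conjugate (y $ i))"

text \<open>A family indexed by \<open>I\<close> is a function, of which only the values on \<open>I\<close> matter.\<close>

definition frame_bounds ::
    "real \<Rightarrow> real \<Rightarrow> 'i set \<Rightarrow> ('i \<Rightarrow> ('a::{real_normed_field,conjugate})^'n) \<Rightarrow> bool" where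
  "frame_bounds A B I f \<longleftrightarrow>
     (\<forall>x. A * (norm x)\<^sup>2 \<le> (\<Sum>i\<in>I. (norm (hinner x (f i)))\<^sup>2) \<and>
          (\<Sum>i\<in>I. (norm (hinner x (f i)))\<^sup>2) \<le> B * (norm x)\<^sup>2)"

definition finite_frame :: "'i set \<Rightarrow> ('i \<Rightarrow> ('a::{real_normed_field,conjugate})^'n) \<Rightarrow> bool" where
  "finite_frame I f \<longleftrightarrow> finite I \<and> (\<exists>A B. A > 0 \<and> B > 0 \<and> frame_bounds A B I f)"

definition tight_frame :: "'i set \<Rightarrow> ('i \<Rightarrow> ('a::{real_normed_field,conjugate})^'n) \<Rightarrow> bool" where
  "tight_frame I f \<longleftrightarrow> finite I \<and> (\<exists>A. A > 0 \<and> frame_bounds A A I f)"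

text \<open>Posets of index sets are represented by their underlying set; the order is inclusion.\<close>

definition factor_poset ::
    "'i set \<Rightarrow> ('i \<Rightarrow> ('a::{real_normed_field,conjugate})^'n) \<Rightarrow> 'i set set" where
  "factor_poset I f = {J. J \<subseteq> I \<and> (J = {} \<or> tight_frame J f)}"

definition empty_cover :: "'i set set \<Rightarrow> 'i set set" where
  "empty_cover P = {J \<in> P. J \<noteq> {} \<and> \<not> (\<exists>J'\<in>P. {} \<subset> J' \<and> J' \<subset> J)}"

end

theory Submission
  imports Defs
begin

text \<open>
  Every member of a factor poset is a disjoint union of members of the empty cover: tightness is
  preserved by disjoint unions and, because the vectors are nonzero, by proper differences, so one
  can keep splitting off minimal members.
\<close>

text \<open>The coordinate vector at a nonzero entry of \<open>f\<close> detects \<open>f\<close>.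
  The sort \<open>conjugatable_ring\<close> guarantees that conjugation vanishes only at 0.\<close>

lemma hinner_nonzero_ex:
  fixes f :: "('a::{real_normed_field,conjugatable_ring})^'n"
  assumes "f \<noteq> 0"
  shows "\<exists>x. hinner x f \<noteq> 0"
proof -
  obtain i where i: "f $ i \<noteq> 0"
    using assms by (auto simp: vec_eq_iff)
  have "hinner (axis i 1) f = (\<Sum>j\<in>UNIV. if j = i then conjugate (f $ j) else 0)"
    unfolding hinner_def by (intro sum.cong) (auto simp: axis_def)
  then have "hinner (axis i 1) f = conjugate (f $ i)"
    by simp
  with i show ?thesis
    by (metis conjugate_zero_iff)
qed

text \<open>With equal bounds the two inequalities collapse to an identity that is additive in the
  index set, so disjoint unions add the constants and differences subtract them.\<close>

lemma frame_bounds_tight_iff: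
  "frame_bounds A A J f \<longleftrightarrow> (\<forall>x. (\<Sum>i\<in>J. (norm (hinner x (f i)))\<^sup>2) = A * (norm x)\<^sup>2)"
  by (auto simp: frame_bounds_def intro: order.antisym)

lemma tight_frame_Un:
  assumes "tight_frame J f" "tight_frame K f" "J \<inter> K = {}"
  shows "tight_frame (J \<union> K) f"
proof -
  obtain A B where "A > 0" "B > 0" "frame_bounds A A J f" "frame_bounds B B K f"
    "finite J" "finite K"
    using assms unfolding tight_frame_def by blast
  with assms(3) have "frame_bounds (A + B) (A + B) (J \<union> K) f" "A + B > 0"
    by (auto simp: frame_bounds_tight_iff sum.union_disjoint distrib_right)
  then show ?thesis
    using \<open>finite J\<close> \<open>finite K\<close> unfolding tight_frame_def by blast
qed

text \<open>The constants subtract to \<open>A - B\<close>; the work lies in showing that this is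
  positive. It is enough to find one \<open>x\<close> at which the remaining sum is
  positive.\<close>

lemma tight_frame_Diff:
  fixes f :: "'i \<Rightarrow> ('a::{real_normed_field,conjugatable_ring})^'n"
  assumes "tight_frame J f" "tight_frame K f" "K \<subset> J" "\<And>i. i \<in> J \<Longrightarrow> f i \<noteq> 0"
  shows "tight_frame (J - K) f"
proof -
  obtain A B where A: "frame_bounds A A J f" and B: "frame_bounds B B K f" and fin: "finite J"
    using assms unfolding tight_frame_def by blast
  have eq: "(\<Sum>i\<in>J - K. (norm (hinner x (f i)))\<^sup>2) = (A - B) * (norm x)\<^sup>2" for x
    using A B fin assms(3) by (simp add: frame_bounds_tight_iff sum_diff left_diff_distrib psubset_imp_subset)
  \<comment> \<open>Since \<open>K\<close> is a proper subset, some index survives. Its vector is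
    nonzero, so a suitable \<open>x\<close> makes its term in the sum positive.\<close>
  obtain i where i: "i \<in> J - K"
    using assms(3) by blast
  then obtain x where x: "hinner x (f i) \<noteq> 0"
    using assms(4) hinner_nonzero_ex by blast
  have "0 < (norm (hinner x (f i)))\<^sup>2"
    using x by simp
  also have "\<dots> \<le> (\<Sum>i\<in>J - K. (norm (hinner x (f i)))\<^sup>2)"
    using fin i by (intro member_le_sum) auto
  finally have "0 < (A - B) * (norm x)\<^sup>2"
    by (simp add: eq)
  then have "A - B > 0"
    by (simp add: zero_less_mult_iff)
  moreover have "frame_bounds (A - B) (A - B) (J - K) f"
    using eq by (simp add: frame_bounds_tight_iff)
  ultimately show ?thesis
    using fin unfolding tight_frame_def by blast
qed

lemma factor_poset_Un:
  assumes "J \<in> factor_poset I f" "K \<in> factor_poset I f" "J \<inter> K = {}"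
  shows "J \<union> K \<in> factor_poset I f"
  using assms tight_frame_Un unfolding factor_poset_def by auto

lemma factor_poset_Diff:
  fixes f :: "'i \<Rightarrow> ('a::{real_normed_field,conjugatable_ring})^'n"
  assumes "J \<in> factor_poset I f" "K \<in> factor_poset I f" "K \<subseteq> J" "\<And>i. i \<in> I \<Longrightarrow> f i \<noteq> 0"
  shows "J - K \<in> factor_poset I f"
\<comment> \<open>In these two cases the difference is \<open>J\<close> or the empty set, and the
  latter belongs to the poset by convention.\<close>
proof (cases "K = {} \<or> K = J")
  case True
  with assms(1) show ?thesis
    by (auto simp: factor_poset_def)
next
  case False
  with assms have "tight_frame (J - K) f"
    by (intro tight_frame_Diff) (auto simp: factor_poset_def)
  with assms(1) show ?thesis
    by (auto simp: factor_poset_def)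
qed

text \<open>Descent: a nonempty member outside the cover has a smaller nonempty member below it, and
  finiteness stops the chain.\<close>

lemma empty_cover_below:
  assumes "J \<in> P" "J \<noteq> {}" "finite J"
  shows "\<exists>K\<in>empty_cover P. K \<subseteq> J"
  using assms(3,1,2)
proof (induction J rule: finite_psubset_induct)
  case (psubset J)
  show ?case
  proof (cases "J \<in> empty_cover P")
    case False
    then obtain J' where "J' \<in> P" "{} \<subset> J'" "J' \<subset> J"
      using psubset.prems unfolding empty_cover_def by blast
    with psubset.IH[of J'] show ?thesis
      by blast
  qed blast
qed

text \<open>The splitting takes place in \<open>P\<close> and the reassembly in \<open>Q\<close>,
  hence differences are demanded of the one and disjoint unions of the other.\<close>

lemma subset_if_empty_cover_subset:
  assumes cover: "empty_cover P \<subseteq> Q" and "{} \<in> Q"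
    and fin: "\<And>J. J \<in> P \<Longrightarrow> finite J"
    and diff: "\<And>J K. J \<in> P \<Longrightarrow> K \<in> P \<Longrightarrow> K \<subseteq> J \<Longrightarrow> J - K \<in> P"
    and un: "\<And>J K. J \<in> Q \<Longrightarrow> K \<in> Q \<Longrightarrow> J \<inter> K = {} \<Longrightarrow> J \<union> K \<in> Q"
  shows "P \<subseteq> Q"
proof
  fix J assume "J \<in> P"
  with fin have "finite J"
    by blast
  then show "J \<in> Q"
    using \<open>J \<in> P\<close>
  proof (induction J rule: finite_psubset_induct)
    case (psubset J)
    show ?case
    proof (cases "J = {}")
      case False
      then obtain K where K: "K \<in> empty_cover P" "K \<subseteq> J"
        using empty_cover_below psubset by metis
      then have "K \<in> P" "K \<noteq> {}"
        by (auto simp: empty_cover_def)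
      \<comment> \<open>As \<open>K\<close> is nonempty, \<open>J - K\<close> is strictly smaller
        than \<open>J\<close>, and \<open>diff\<close> keeps it in \<open>P\<close>; so the
        induction hypothesis applies.\<close>
      with K psubset have "J - K \<in> Q"
        by (intro psubset.IH) (auto intro: diff)
      moreover have "K \<in> Q"
        using K cover by blast
      ultimately have "K \<union> (J - K) \<in> Q"
        by (intro un) auto
      with K show ?thesis
        by (simp add: Un_absorb1)
    qed (use \<open>{} \<in> Q\<close> in simp)
  qed
qed

text \<open>The two families are compared only through sets of indices, so their scalars and
  dimensions may differ.\<close>

lemma empty_cover_factor_poset_eq_iff:
  fixes f :: "'i \<Rightarrow> ('a::{real_normed_field,conjugatable_ring})^'n"
    and g :: "'i \<Rightarrow> ('b::{real_normed_field,conjugatable_ring})^'m"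
  assumes "finite I" "\<And>i. i \<in> I \<Longrightarrow> f i \<noteq> 0" "\<And>i. i \<in> I \<Longrightarrow> g i \<noteq> 0"
  shows "empty_cover (factor_poset I f) = empty_cover (factor_poset I g) \<longleftrightarrow>
         factor_poset I f = factor_poset I g"
proof
  assume eq: "empty_cover (factor_poset I f) = empty_cover (factor_poset I g)"
  have empty: "{} \<in> factor_poset I f" "{} \<in> factor_poset I g"
    by (auto simp: factor_poset_def)
  have fin: "finite J" if "J \<in> factor_poset I f \<or> J \<in> factor_poset I g" for J
    using that assms(1) by (auto simp: factor_poset_def intro: finite_subset)
  \<comment> \<open>Together with \<open>eq\<close>, this places the cover of each poset inside the
    other poset, which is the premise \<open>cover\<close> in both directions.\<close>
  have sub: "empty_cover P \<subseteq> P" for P :: "'i set set"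
    by (auto simp: empty_cover_def)
  have "factor_poset I f \<subseteq> factor_poset I g"
    by (rule subset_if_empty_cover_subset)
      (use eq sub empty fin assms in \<open>auto intro: factor_poset_Un factor_poset_Diff\<close>)
  moreover have "factor_poset I g \<subseteq> factor_poset I f"
    by (rule subset_if_empty_cover_subset)
      (use eq sub empty fin assms in \<open>auto intro: factor_poset_Un factor_poset_Diff\<close>)
  ultimately show "factor_poset I f = factor_poset I g"
    by blast
qed simp

theorem corollary3p9:
  fixes k :: nat
  shows "(\<forall>(F :: nat \<Rightarrow> real^'n) (G :: nat \<Rightarrow> real^'n).
            finite_frame {1..k} F \<and> finite_frame {1..k} G \<and>
            (\<forall>i\<in>{1..k}. F i \<noteq> 0) \<and> (\<forall>i\<in>{1..k}. G i \<noteq> 0) \<longrightarrow>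
            (empty_cover (factor_poset {1..k} F) = empty_cover (factor_poset {1..k} G) \<longleftrightarrow>
             factor_poset {1..k} F = factor_poset {1..k} G)) \<and>
         (\<forall>(F :: nat \<Rightarrow> complex^'n) (G :: nat \<Rightarrow> complex^'n).
            finite_frame {1..k} F \<and> finite_frame {1..k} G \<and>
            (\<forall>i\<in>{1..k}. F i \<noteq> 0) \<and> (\<forall>i\<in>{1..k}. G i \<noteq> 0) \<longrightarrow>
            (empty_cover (factor_poset {1..k} F) = empty_cover (factor_poset {1..k} G) \<longleftrightarrow>
             factor_poset {1..k} F = factor_poset {1..k} G))"
  \<comment> \<open>Both \<open>real\<close> and \<open>complex\<close> belong to the sort of the
    lemma, so it settles each conjunct.\<close>
  by (intro conjI allI impI empty_cover_factor_poset_eq_iff) auto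

end
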